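(* Let $\Gamma$ be a finite group and let $\mathcal F=\{f_g\}_{g\in\Gamma}\subset\mathbb Z_2^n$ be a binary $\Gamma$-frame generated by a group representation $\rho:\Gamma\to \mathrm{GL}(\mathbb Z_2^n)$ (so $f_g=\rho_g f_e$ for all $g\in\Gamma$). If $\mathcal F$ is Parseval with analysis operator $\Theta$, then $\rho$ is a unitary representation, with matrices explicitly given by $\rho_g=\Theta^*\Lambda_g\Theta$ for each $g\in\Gamma$, where $\Lambda$ is the left regular representation of $\Gamma$ on $\mathbb Z_2^\Gamma$.
   Context: All vectors and matrices are over the field $\mathbb Z_2$ with two elements; $T^*$ denotes the transpose of $T$. The dot product on $\mathbb Z_2^n$ is $\langle a,b\rangle=\sum_{i=1}^n a_ib_i\in\mathbb Z_2$. A finite family $\{f_j\}_{j\in J}$ in $\mathbb Z_2^n$ is a binary frame if it spans $\mathbb Z_2^n$, and a binary Parseval frame if $x=\sum_{j\in J}\langle x,f_j\rangle f_j$ for all $x\in\mathbb Z_2^n$. For a finite group $\Gamma$ with identity $e$ and a representation (group homomorphism) $\rho:\Gamma\to \mathrm{GL}(\mathbb Z_2^n)$, written $g\mapsto\rho_g$, and $f\in\mathbb Z_2^n$, put $f_e:=f$ and $f_g:=\rho_g f$. If the family $\{f_g\}_{g\in\Gamma}$ spans $\mathbb Z_2^n$ it is called a binary group frame, or $\Gamma$-frame, generated by $\rho$; it is a binary Parseval $\Gamma$-frame if it is also Parseval. A binary $n\times n$ matrix $U$ is unitary if $UU^*=U^*U=I_n$; a representation is unitary if all of its matrices $\rho_g$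 are unitary. The analysis operator of $\mathcal F=\{f_g\}_{g\in\Gamma}$ is $\Theta:\mathbb Z_2^n\to\mathbb Z_2^\Gamma$, $(\Theta x)(g)=\langle x,f_g\rangle$, where $\mathbb Z_2^\Gamma$ is the space of $\mathbb Z_2$-valued functions on $\Gamma$; its adjoint (synthesis operator) is $\Theta^*h=\sum_{g\in\Gamma}h(g)f_g$. The left regular representation acts by $(\Lambda_g\varphi)(h)=\varphi(g^{-1}h)$ for $\varphi\in\mathbb Z_2^\Gamma$, $g,h\in\Gamma$. *)

theory Defs
  imports
    "HOL-Analysis.Cartesian_Space"
    "HOL-Algebra.Group"
    "HOL-Library.Z2"
begin

text \<open>
  The field $\mathbb Z_2$ is \<^typ>\<open>bit\<close>, and $\mathbb Z_2^n$ is \<^typ>\<open>bit ^ 'n\<close>, an \<open>n\<close>-by-\<open>n\<close>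
  matrix having type \<^typ>\<open>bit ^ 'n ^ 'n\<close>.
  The inner product of the library is available over the reals only.
\<close>

definition dot :: "bit ^ 'n \<Rightarrow> bit ^ 'n \<Rightarrow> bit" where
  "dot a b = (\<Sum>i\<in>UNIV. a $ i * b $ i)"

text \<open>Families \<open>{f\<^sub>j}\<close> with \<open>j \<in> J\<close>; only the values of \<open>f\<close> on \<open>J\<close> matter. The span
  \<^term>\<open>vec.span\<close> is the linear span over \<^typ>\<open>bit\<close>.\<close>

definition binary_frame :: "'j set \<Rightarrow> ('j \<Rightarrow> bit ^ 'n) \<Rightarrow> bool" where
  "binary_frame J f \<longleftrightarrow> finite J \<and> vec.span (f ` J) = UNIV"

definition binary_parseval_frame :: "'j set \<Rightarrow> ('j \<Rightarrow> bit ^ 'n) \<Rightarrow> bool" where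
  "binary_parseval_frame J f \<longleftrightarrow> finite J \<and> (\<forall>x. x = (\<Sum>j\<in>J. dot x (f j) *s f j))"

definition GL :: "(bit ^ 'n ^ 'n) monoid" where
  "GL = \<lparr>carrier = {A. invertible A}, mult = (**), one = mat 1\<rparr>"

lemma group_GL: "group GL"
proof (rule groupI)
  fix A :: "bit ^ 'n ^ 'n"
  assume "A \<in> carrier GL"
  then obtain B where "A ** B = mat 1" "B ** A = mat 1"
    by (auto simp: GL_def invertible_def)
  then show "\<exists>B \<in> carrier GL. B \<otimes>\<^bsub>GL\<^esub> A = \<one>\<^bsub>GL\<^esub>"
    by (auto simp: GL_def invertible_def)
next
  show "\<one>\<^bsub>GL\<^esub> \<in> carrier GL"
    by (auto simp: GL_def invertible_def intro!: exI[of _ "mat 1"])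
qed (auto simp: GL_def invertible_mult matrix_mul_assoc)

definition representation :: "('g, 'm) monoid_scheme \<Rightarrow> ('g \<Rightarrow> bit ^ 'n ^ 'n) \<Rightarrow> bool" where
  "representation G \<rho> \<longleftrightarrow> \<rho> \<in> hom G GL"

text \<open>A binary matrix \<open>U\<close> is unitary if $U U^* = U^* U = I$ with $U^*$ the transpose of \<open>U\<close>,
  which is what \<^const>\<open>orthogonal_matrix\<close> says over an arbitrary semiring.\<close>

definition unitary_representation :: "('g, 'm) monoid_scheme \<Rightarrow> ('g \<Rightarrow> bit ^ 'n ^ 'n) \<Rightarrow> bool" where
  "unitary_representation G \<rho> \<longleftrightarrow>
     representation G \<rho> \<and> (\<forall>g\<in>carrier G. orthogonal_matrix (\<rho> g))"

definition group_frame ::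
  "('g, 'm) monoid_scheme \<Rightarrow> ('g \<Rightarrow> bit ^ 'n ^ 'n) \<Rightarrow> ('g \<Rightarrow> bit ^ 'n) \<Rightarrow> bool" where
  "group_frame G \<rho> f \<longleftrightarrow>
     representation G \<rho> \<and> (\<forall>g\<in>carrier G. f g = \<rho> g *v f \<one>\<^bsub>G\<^esub>) \<and> binary_frame (carrier G) f"

text \<open>$\mathbb Z_2^\Gamma$ is rendered by \<^term>\<open>carrier G \<rightarrow>\<^sub>E (UNIV :: bit set)\<close>: functions are made
  extensional, that is, \<^const>\<open>undefined\<close> outside the carrier.\<close>

definition analysis :: "('g, 'm) monoid_scheme \<Rightarrow> ('g \<Rightarrow> bit ^ 'n) \<Rightarrow> bit ^ 'n \<Rightarrow> 'g \<Rightarrow> bit" where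
  "analysis G f x = (\<lambda>g\<in>carrier G. dot x (f g))"

definition synthesis :: "('g, 'm) monoid_scheme \<Rightarrow> ('g \<Rightarrow> bit ^ 'n) \<Rightarrow> ('g \<Rightarrow> bit) \<Rightarrow> bit ^ 'n" where
  "synthesis G f h = (\<Sum>g\<in>carrier G. h g *s f g)"

lemma synthesis_adjoint_analysis:
  "(\<Sum>g\<in>carrier G. analysis G f x g * h g) = dot x (synthesis G f h)"
proof -
  have "(\<Sum>g\<in>carrier G. analysis G f x g * h g) =
    (\<Sum>g\<in>carrier G. \<Sum>i\<in>UNIV. x $ i * (h g * f g $ i))"
    by (intro sum.cong refl) (simp only: analysis_def restrict_apply' dot_def sum_distrib_left mult_ac)
  also have "\<dots> = (\<Sum>i\<in>UNIV. \<Sum>g\<in>carrier G. x $ i * (h g * f g $ i))"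
    by (rule sum.swap)
  also have "\<dots> = dot x (synthesis G f h)"
    by (simp only: dot_def synthesis_def sum_component vector_smult_component sum_distrib_left)
  finally show ?thesis .
qed

definition left_regular :: "('g, 'm) monoid_scheme \<Rightarrow> 'g \<Rightarrow> ('g \<Rightarrow> bit) \<Rightarrow> 'g \<Rightarrow> bit" where
  "left_regular G g \<phi> = (\<lambda>h\<in>carrier G. \<phi> (inv\<^bsub>G\<^esub> g \<otimes>\<^bsub>G\<^esub> h))"

end

theory Submission
  imports Defs
begin

text \<open>
  Left translation by \<open>g\<close> permutes the frame, and \<open>\<rho>\<^sub>g\<close> implements it. Applying \<open>\<rho>\<^sub>g\<close> to the
  Parseval expansion of \<open>x\<close> and reindexing gives the explicit formula; applying it to the
  expansion of \<open>\<rho>\<^sub>g\<^sup>* x\<close> turns that into the expansion of \<open>x\<close>, so \<open>\<rho>\<^sub>g \<rho>\<^sub>g\<^sup>* = I\<close>.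
\<close>

text \<open>Exchanging the two finite summations shows that the transpose is the adjoint for
  \<open>dot\<close>. This is what moves \<open>\<rho> g\<close> from the argument of a frame
  coefficient onto the frame vector.\<close>

lemma dot_transpose_mult:
  fixes A :: "bit ^ 'n ^ 'm"
  shows "dot (transpose A *v x) y = dot x (A *v y)"
proof -
  have "dot (transpose A *v x) y = (\<Sum>i\<in>UNIV. \<Sum>j\<in>UNIV. x $ j * (A $ j $ i * y $ i))"
    by (simp only: dot_def matrix_vector_mult_def transpose_def vec_lambda_beta
        sum_distrib_left sum_distrib_right mult_ac)
  also have "\<dots> = (\<Sum>j\<in>UNIV. \<Sum>i\<in>UNIV. x $ j * (A $ j $ i * y $ i))"
    by (rule sum.swap)
  also have "\<dots> = dot x (A *v y)"
    by (simp only: dot_def matrix_vector_mult_def vec_lambda_beta sum_distrib_left)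
  finally show ?thesis .
qed

lemma (in group) sum_left_translate:
  assumes "g \<in> carrier G"
  shows "(\<Sum>h\<in>carrier G. F (g \<otimes> h)) = sum F (carrier G)"
proof (rule sum.reindex_bij_betw)
  show "bij_betw ((\<otimes>) g) (carrier G) (carrier G)"
    using assms by (simp add: bij_betw_def inj_on_cmult surj_const_mult)
qed

text \<open>\<open>group_frame\<close> describes only the orbit of the vector at the identity;
  multiplicativity of \<open>\<rho>\<close> extends this to the action on every frame
  vector.\<close>

lemma group_frame_mult:
  assumes "group G" "group_frame G \<rho> f" "g \<in> carrier G" "h \<in> carrier G"
  shows "f (g \<otimes>\<^bsub>G\<^esub> h) = \<rho> g *v f h"
proof -
  interpret group G by fact
  have orbit: "f k = \<rho> k *v f \<one>\<^bsub>G\<^esub>" if "k \<in> carrier G" for k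
    using assms(2) that unfolding group_frame_def by blast
  have "f (g \<otimes>\<^bsub>G\<^esub> h) = \<rho> (g \<otimes>\<^bsub>G\<^esub> h) *v f \<one>\<^bsub>G\<^esub>"
    using assms(3,4) by (intro orbit m_closed)
  also have "\<rho> (g \<otimes>\<^bsub>G\<^esub> h) = \<rho> g ** \<rho> h"
  proof -
    have "\<rho> \<in> hom G GL"
      using assms(2) unfolding group_frame_def representation_def by blast
    from hom_mult[OF this assms(3,4)] show ?thesis
      by (simp add: GL_def)
  qed
  also have "(\<rho> g ** \<rho> h) *v f \<one>\<^bsub>G\<^esub> = \<rho> g *v f h"
    by (simp only: orbit[OF assms(4)] matrix_vector_mul_assoc)
  finally show ?thesis .
qed

lemma parseval_expansion:
  assumes "binary_parseval_frame J f"
  shows "x = (\<Sum>j\<in>J. dot x (f j) *s f j)"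
  using assms unfolding binary_parseval_frame_def by blast

text \<open>Common source of unitarity and of the explicit formula: by linearity
  \<open>\<rho> g\<close> passes through the Parseval expansion, shifting the vectors while the
  coefficients keep the index \<open>h\<close>.\<close>

lemma parseval_group_frame_mult:
  assumes "group G" "group_frame G \<rho> f" "binary_parseval_frame (carrier G) f"
    and g: "g \<in> carrier G"
  shows "\<rho> g *v x = (\<Sum>h\<in>carrier G. dot x (f h) *s f (g \<otimes>\<^bsub>G\<^esub> h))"
proof -
  have "\<rho> g *v x = \<rho> g *v (\<Sum>h\<in>carrier G. dot x (f h) *s f h)"
    by (rule arg_cong[OF parseval_expansion[OF assms(3)]])
  also have "\<dots> = (\<Sum>h\<in>carrier G. dot x (f h) *s (\<rho> g *v f h))"
    by (simp only: vec.linear_sum[OF matrix_vector_mul_linear_gen] vector_scalar_commute)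
  also have "\<dots> = (\<Sum>h\<in>carrier G. dot x (f h) *s f (g \<otimes>\<^bsub>G\<^esub> h))"
    by (intro sum.cong refl) (simp only: group_frame_mult[OF assms(1,2) g])
  finally show ?thesis .
qed

lemma parseval_group_frame_orthogonal:
  assumes "group G" "group_frame G \<rho> f" "binary_parseval_frame (carrier G) f"
    and g: "g \<in> carrier G"
  shows "orthogonal_matrix (\<rho> g)"
proof -
  interpret group G by fact
  have "(\<rho> g ** transpose (\<rho> g)) *v x = x" for x
  proof -
    have "(\<rho> g ** transpose (\<rho> g)) *v x = \<rho> g *v (transpose (\<rho> g) *v x)"
      by (simp only: matrix_vector_mul_assoc)
    also have "\<dots> = (\<Sum>h\<in>carrier G. dot (transpose (\<rho> g) *v x) (f h) *s f (g \<otimes>\<^bsub>G\<^esub> h))"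
      by (rule parseval_group_frame_mult[OF assms])
    \<comment> \<open>Adjointness turns the coefficient into \<open>dot x (\<rho> g *v f h)\<close>,
      so coefficient and vector now carry the same shifted index.\<close>
    also have "\<dots> = (\<Sum>h\<in>carrier G. dot x (f (g \<otimes>\<^bsub>G\<^esub> h)) *s f (g \<otimes>\<^bsub>G\<^esub> h))"
      by (intro sum.cong refl) (simp only: dot_transpose_mult group_frame_mult[OF assms(1,2) g])
    also have "\<dots> = (\<Sum>h\<in>carrier G. dot x (f h) *s f h)"
      by (rule sum_left_translate[OF g, where F = "\<lambda>h. dot x (f h) *s f h"])
    also have "\<dots> = x"
      by (rule parseval_expansion[OF assms(3), symmetric])
    finally show ?thesis .
  qed
  then have "\<rho> g ** transpose (\<rho> g) = mat 1"
    by (simp add: matrix_eq)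
  \<comment> \<open>\<open>orthogonal_matrix\<close> asks for both products; for square matrices
    over a field a one-sided inverse is two-sided.\<close>
  then show ?thesis
    by (simp add: orthogonal_matrix_def matrix_left_right_inverse)
qed

lemma parseval_group_frame_synthesis:
  assumes "group G" "group_frame G \<rho> f" "binary_parseval_frame (carrier G) f"
    and g: "g \<in> carrier G"
  shows "\<rho> g *v x = synthesis G f (left_regular G g (analysis G f x))"
proof -
  interpret group G by fact
  have "\<rho> g *v x = (\<Sum>h\<in>carrier G. dot x (f h) *s f (g \<otimes>\<^bsub>G\<^esub> h))"
    by (rule parseval_group_frame_mult[OF assms])
  \<comment> \<open>At the point \<open>gh\<close>, the operator \<Lambda>_g reads off the analysis
    coefficient at \<open>inv g\<close> times \<open>gh\<close>, which is \<open>h\<close>. All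
    these points lie in the carrier, so the restrictions do not interfere.\<close>
  also have "\<dots> = (\<Sum>h\<in>carrier G. left_regular G g (analysis G f x) (g \<otimes>\<^bsub>G\<^esub> h) *s f (g \<otimes>\<^bsub>G\<^esub> h))"
    using g by (intro sum.cong refl)
      (simp add: left_regular_def analysis_def m_assoc[symmetric])
  also have "\<dots> = synthesis G f (left_regular G g (analysis G f x))"
    unfolding synthesis_def
    by (rule sum_left_translate[OF g, where F = "\<lambda>h. left_regular G g (analysis G f x) h *s f h"])
  finally show ?thesis .
qed

theorem proposition2p13:
  fixes G :: "('g, 'm) monoid_scheme"
    and \<rho> :: "'g \<Rightarrow> bit ^ 'n ^ 'n"
    and f :: "'g \<Rightarrow> bit ^ 'n"
  assumes "group G" and "finite (carrier G)"
    and "group_frame G \<rho> f"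
    and "binary_parseval_frame (carrier G) f"
  shows "unitary_representation G \<rho> \<and>
    (\<forall>g\<in>carrier G. (*v) (\<rho> g) = synthesis G f \<circ> left_regular G g \<circ> analysis G f)"
proof (intro conjI ballI ext)
  show "unitary_representation G \<rho>"
    unfolding unitary_representation_def
  proof
    show "representation G \<rho>"
      using assms(3) unfolding group_frame_def by blast
    show "\<forall>g\<in>carrier G. orthogonal_matrix (\<rho> g)"
      using parseval_group_frame_orthogonal[OF assms(1,3,4)] by (rule ballI)
  qed
  show "\<rho> g *v x = (synthesis G f \<circ> left_regular G g \<circ> analysis G f) x"
    if "g \<in> carrier G" for g x
    unfolding comp_apply by (rule parseval_group_frame_synthesis[OF assms(1,3,4) that])
qed

end
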